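(* Let $Y=\{Y(t),t\in\mathbb{R}^d\}$ be a real-valued measurable centered stationary Gaussian random field with covariance function $C(t)=\mathbf{E}[Y(t)Y(0)]$, $\mathbf{E}[Y^2(0)]=1$, which is positively associated (PA) or negatively associated (NA), and suppose $C(t)\to0$ as $\|t\|\to\infty$. Let $(W_n)_{n\in\mathbb{N}}$ be a van Hove sequence of observation windows in $\mathbb{R}^d$, let $r_{n,l}>0$, $1\le l\le d$, $n\in\mathbb{N}$, and let $$V_n=\left\{\left(\frac{x_1}{r_{n,1}},\ldots,\frac{x_d}{r_{n,d}}\right):(x_1,\ldots,x_d)\in W_n\right\}$$ satisfy $\sup_{n\ge1}\nu_d(V_n)<\infty$. Assume there is a Borel set $V\subset\mathbb{R}^d$ such that $\nu_d(W_n)\sim\nu_d(V)\prod_{l=1}^dr_{n,l}$ and $\nu_d(V\Delta V_n)\to0$ as $n\to\infty$. If for some $\delta\in(0,1)$ $$\prod_{i=1}^dr_{n,i}^{-1+\delta}\int_{\{|t_i|\le r_{n,i},\,1\le i\le d\}}C(t)\,\nu_d(dt)\to+\infty,\quad n\to\infty,$$ then $$\frac{\int_{\mathbb{R}^d}C^2(t)\,\nu_d(W_n\cap(W_n-t))\,\nu_d(dt)}{\int_{\mathbb{R}^d}C(t)\,\nu_d(W_n\cap(W_n-t))\,\nu_d(dt)}\to0,\quad n\to\infty.$$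
   Context: $\nu_d$ is Lebesgue measure on $\mathbb{R}^d$. A Gaussian random field is PA (respectively NA) if its covariance function is non-negative (respectively non-positive). A sequence $(W_n)$ of compact subsets of $\mathbb{R}^d$ is a van Hove sequence if $\nu_d(W_n)\to\infty$ and, for every $r>0$, $\nu_d(\partial W_n\oplus B_r(0))/\nu_d(W_n)\to0$ as $n\to\infty$, where $\partial W_n$ is the boundary, $\oplus$ is the Minkowski sum and $B_r(0)=\{x:\|x\|<r\}$. $V\Delta V_n$ is the symmetric difference; $\alpha_n\sim\beta_n$ means $\alpha_n/\beta_n\to1$. *)

theory Defs
  imports "HOL-Probability.Probability"
begin

text \<open>A real random variable is Gaussian if it has a normal law; as usual, the degenerate
  laws (variance zero) are included.\<close>

definition gaussian_rv :: "'w measure \<Rightarrow> ('w \<Rightarrow> real) \<Rightarrow> bool" where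
  "gaussian_rv M X \<longleftrightarrow> X \<in> borel_measurable M \<and>
     ((\<exists>m. AE w in M. X w = m) \<or>
      (\<exists>m s. 0 < s \<and> distributed M lborel X (\<lambda>x. ennreal (normal_density m s x))))"

text \<open>All finite-dimensional distributions are multivariate normal, i.e. all finite linear
  combinations of values of the field are Gaussian.\<close>

definition gaussian_field :: "'w measure \<Rightarrow> ('t \<Rightarrow> 'w \<Rightarrow> real) \<Rightarrow> bool" where
  "gaussian_field M Y \<longleftrightarrow>
     (\<forall>I c. finite I \<longrightarrow> gaussian_rv M (\<lambda>w. \<Sum>t\<in>I. c t * Y t w))"

definition measurable_field ::
    "'w measure \<Rightarrow> ('t::topological_space \<Rightarrow> 'w \<Rightarrow> real) \<Rightarrow> bool" where
  "measurable_field M Y \<longleftrightarrow> (\<lambda>(t, w). Y t w) \<in> borel_measurable (borel \<Otimes>\<^sub>M M)"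

definition centered_field :: "'w measure \<Rightarrow> ('t \<Rightarrow> 'w \<Rightarrow> real) \<Rightarrow> bool" where
  "centered_field M Y \<longleftrightarrow> (\<forall>t. integrable M (Y t) \<and> (\<integral>w. Y t w \<partial>M) = 0)"

definition stationary_field :: "'w measure \<Rightarrow> ('t::ab_group_add \<Rightarrow> 'w \<Rightarrow> real) \<Rightarrow> bool" where
  "stationary_field M Y \<longleftrightarrow>
     (\<forall>h I. finite I \<longrightarrow>
        distr M (\<Pi>\<^sub>M t\<in>I. borel) (\<lambda>w. \<lambda>t\<in>I. Y (t + h) w) =
        distr M (\<Pi>\<^sub>M t\<in>I. borel) (\<lambda>w. \<lambda>t\<in>I. Y t w))"

definition field_cov :: "'w measure \<Rightarrow> ('t \<Rightarrow> 'w \<Rightarrow> real) \<Rightarrow> 't \<Rightarrow> 't \<Rightarrow> real" where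
  "field_cov M Y s t =
     (\<integral>w. (Y s w - (\<integral>v. Y s v \<partial>M)) * (Y t w - (\<integral>v. Y t v \<partial>M)) \<partial>M)"

text \<open>Positive and negative association of a Gaussian field, in terms of its covariance function.
  Variances are always non-negative, so non-positivity is required off the diagonal only.\<close>

definition gaussian_PA :: "'w measure \<Rightarrow> ('t \<Rightarrow> 'w \<Rightarrow> real) \<Rightarrow> bool" where
  "gaussian_PA M Y \<longleftrightarrow> (\<forall>s t. 0 \<le> field_cov M Y s t)"

definition gaussian_NA :: "'w measure \<Rightarrow> ('t \<Rightarrow> 'w \<Rightarrow> real) \<Rightarrow> bool" where
  "gaussian_NA M Y \<longleftrightarrow> (\<forall>s t. s \<noteq> t \<longrightarrow> field_cov M Y s t \<le> 0)"

definition van_Hove :: "(nat \<Rightarrow> 'a::euclidean_space set) \<Rightarrow> bool" where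
  "van_Hove W \<longleftrightarrow>
     (\<forall>n. compact (W n)) \<and>
     filterlim (\<lambda>n. measure lborel (W n)) at_top sequentially \<and>
     (\<forall>r>0. (\<lambda>n. measure lborel {x + y | x y. x \<in> frontier (W n) \<and> y \<in> ball 0 r}
                  / measure lborel (W n)) \<longlonglongrightarrow> 0)"

definition rescale :: "('d \<Rightarrow> real) \<Rightarrow> (real ^ 'd) set \<Rightarrow> (real ^ 'd) set" where
  "rescale r A = (\<lambda>x. \<chi> l. x $ l / r l) ` A"

definition overlap :: "'a::euclidean_space set \<Rightarrow> 'a \<Rightarrow> real" where
  "overlap A t = measure lborel (A \<inter> (\<lambda>x. x - t) ` A)"

end

theory Submission
  imports Defs
begin

text \<open>
  If the field is negatively associated, then \<open>C \<le> 0\<close> off the origin, the box integrals in the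
  growth hypothesis are non-positive, and they cannot tend to infinity. So only the positively
  associated case remains, where \<open>0 \<le> C \<le> 1\<close>. Write \<open>g\<^sub>n\<close> for the overlap function
  \<open>t \<mapsto> \<nu>(W\<^sub>n \<inter> (W\<^sub>n - t))\<close>, which is at most \<open>\<nu>(W\<^sub>n)\<close>, and \<open>R\<^sub>n\<close> for the product of the
  scales \<open>r\<^sub>n\<close>.

  Since \<open>C\<close> vanishes at infinity, for every \<open>\<epsilon> > 0\<close> there is a ball outside which
  \<open>C\<^sup>2 \<le> \<epsilon> C\<close>. Hence the numerator is at most \<open>\<epsilon>\<close> times the denominator plus a constant multiple
  of \<open>\<nu>(W\<^sub>n)\<close>, and everything reduces to showing that the denominator grows faster than
  \<open>\<nu>(W\<^sub>n)\<close>, equivalently faster than \<open>R\<^sub>n\<close>.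

  Rescaling turns \<open>g\<^sub>n(t)\<close> into \<open>R\<^sub>n\<close> times the overlap of \<open>V\<^sub>n\<close> at the point with coordinates
  \<open>t\<^sub>l / r\<^sub>n\<^sub>l\<close>. The overlap of the limit set \<open>V\<close> is close to \<open>\<nu>(V)\<close> near the origin
  (\<open>overlap_near_zero\<close>), and \<open>V\<^sub>n\<close> inherits this because it differs little from \<open>V\<close>
  (\<open>overlap_perturb\<close>). So there is \<open>\<eta> > 0\<close> such that, for large \<open>n\<close>, the denominator is at least
  \<open>\<nu>(V) R\<^sub>n / 2\<close> times the integral of \<open>C\<close> over the box with half-widths \<open>\<eta> r\<^sub>n\<close>.

  The hypothesis makes the integral of \<open>C\<close> over the box with half-widths \<open>r\<^sub>n\<close> tend to infinity,
  because \<open>R\<^sub>n \<ge> 1\<close> for large \<open>n\<close>. What is left is to pass from \<open>r\<^sub>n\<close> to the smaller box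
  \<open>\<eta> r\<^sub>n\<close>, and this is where \<open>C\<close> being a covariance matters: a non-negative positive definite
  function has, up to a factor depending on the dimension only, no more mass on a translated box
  than on four times that box put at the origin (\<open>posdef_translated_box_le\<close>). Covering the box
  \<open>r\<^sub>n\<close> by a number of translates that does not depend on \<open>n\<close> then gives
  \<open>posdef_box_shrink\<close>.
\<close>

section \<open>Second moments of stationary fields\<close>

lemma measurable_field_at:
  assumes "measurable_field M Y"
  shows "Y t \<in> borel_measurable M"
proof -
  have "(\<lambda>w. (case (t, w) of (t, w) \<Rightarrow> Y t w)) \<in> borel_measurable M"
    by (rule measurable_compose[OF _ assms[unfolded measurable_field_def]]) simp
  then show ?thesis by simp
qed

lemma stationary_second_moment:
  fixes Y :: "'t::ab_group_add \<Rightarrow> 'w \<Rightarrow> real"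
  assumes "stationary_field M Y" and meas: "\<And>t. Y t \<in> borel_measurable M"
  shows "(\<integral>w. Y (s + h) w * Y (t + h) w \<partial>M) = (\<integral>w. Y s w * Y t w \<partial>M)"
    and "integrable M (\<lambda>w. Y (s + h) w * Y (t + h) w) \<longleftrightarrow> integrable M (\<lambda>w. Y s w * Y t w)"
proof -
  let ?P = "\<Pi>\<^sub>M u\<in>{s, t}. borel :: real measure"
  have eq: "distr M ?P (\<lambda>w. \<lambda>u\<in>{s, t}. Y (u + h) w) = distr M ?P (\<lambda>w. \<lambda>u\<in>{s, t}. Y u w)"
    by (rule assms(1)[unfolded stationary_field_def, rule_format]) simp
  have X: "(\<lambda>w. \<lambda>u\<in>{s, t}. Y (u + k) w) \<in> measurable M ?P" for k
    by (intro measurable_restrict meas)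
  have g: "(\<lambda>x. x s * x t) \<in> borel_measurable ?P"
    by (intro borel_measurable_times measurable_component_singleton) auto
  have i: "(\<integral>x. x s * x t \<partial>distr M ?P (\<lambda>w. \<lambda>u\<in>{s, t}. Y (u + k) w))
        = (\<integral>w. Y (s + k) w * Y (t + k) w \<partial>M)" for k
    by (subst integral_distr[OF X g]) simp
  have j: "integrable (distr M ?P (\<lambda>w. \<lambda>u\<in>{s, t}. Y (u + k) w)) (\<lambda>x. x s * x t)
        \<longleftrightarrow> integrable M (\<lambda>w. Y (s + k) w * Y (t + k) w)" for k
    by (subst integrable_distr_eq[OF X g]) simp
  show "(\<integral>w. Y (s + h) w * Y (t + h) w \<partial>M) = (\<integral>w. Y s w * Y t w \<partial>M)"
    using i[of h] i[of 0] eq by simp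
  show "integrable M (\<lambda>w. Y (s + h) w * Y (t + h) w) \<longleftrightarrow> integrable M (\<lambda>w. Y s w * Y t w)"
    using j[of h] j[of 0] eq by simp
qed

lemma integrable_times_of_squares:
  fixes X Z :: "'w \<Rightarrow> real"
  assumes "X \<in> borel_measurable M" "Z \<in> borel_measurable M"
    and "integrable M (\<lambda>w. (X w)\<^sup>2)" "integrable M (\<lambda>w. (Z w)\<^sup>2)"
  shows "integrable M (\<lambda>w. X w * Z w)"
    and "(\<integral>w. \<bar>X w * Z w\<bar> \<partial>M) \<le> ((\<integral>w. (X w)\<^sup>2 \<partial>M) + (\<integral>w. (Z w)\<^sup>2 \<partial>M)) / 2"
proof -
  have le: "\<bar>X w * Z w\<bar> \<le> ((X w)\<^sup>2 + (Z w)\<^sup>2) / 2" for w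
    using sum_squares_bound[of "\<bar>X w\<bar>" "\<bar>Z w\<bar>"] by (simp add: abs_mult)
  have int: "integrable M (\<lambda>w. ((X w)\<^sup>2 + (Z w)\<^sup>2) / 2)"
    using assms by simp
  show 1: "integrable M (\<lambda>w. X w * Z w)"
    by (rule Bochner_Integration.integrable_bound[OF int]) (use assms le in \<open>auto\<close>)
  have "(\<integral>w. \<bar>X w * Z w\<bar> \<partial>M) \<le> (\<integral>w. ((X w)\<^sup>2 + (Z w)\<^sup>2) / 2 \<partial>M)"
    by (rule integral_mono) (use 1 int le in auto)
  also have "\<dots> = ((\<integral>w. (X w)\<^sup>2 \<partial>M) + (\<integral>w. (Z w)\<^sup>2 \<partial>M)) / 2"
    using assms by simp
  finally show "(\<integral>w. \<bar>X w * Z w\<bar> \<partial>M) \<le> ((\<integral>w. (X w)\<^sup>2 \<partial>M) + (\<integral>w. (Z w)\<^sup>2 \<partial>M)) / 2" .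
qed

lemma integrable_tensor:
  fixes \<phi> :: "'a::euclidean_space \<Rightarrow> real"
  assumes "integrable lborel \<phi>"
  shows "integrable (lborel \<Otimes>\<^sub>M lborel) (\<lambda>(s, t). \<phi> s * \<phi> t)"
proof -
  have [measurable]: "\<phi> \<in> borel_measurable lborel" using assms by auto
  show ?thesis
    by (rule lborel_pair.Fubini_integrable) (use assms in \<open>auto simp: abs_mult\<close>)
qed

text \<open>The \<open>L\<^sup>1\<close> form of positive definiteness: for bounded Borel \<open>C\<close> the double integral converges
  absolutely for every integrable \<open>\<phi>\<close>.\<close>

definition kernel_posdef :: "('a::euclidean_space \<Rightarrow> real) \<Rightarrow> bool" where
  "kernel_posdef C \<longleftrightarrow> (\<forall>\<phi>. integrable lborel \<phi> \<longrightarrow>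
     0 \<le> (LINT p|(lborel \<Otimes>\<^sub>M lborel). \<phi> (fst p) * \<phi> (snd p) * C (fst p - snd p)))"

text \<open>By Fubini, the double integral of \<open>\<phi>(s) \<phi>(t) E(Y\<^sub>s Y\<^sub>t)\<close> is the second moment of the random
  variable \<open>\<integral> \<phi>(t) Y\<^sub>t dt\<close>. Bounded variances are what makes Fubini applicable.\<close>

lemma second_moment_posdef:
  fixes Y :: "'a::euclidean_space \<Rightarrow> 'w \<Rightarrow> real"
  assumes M: "prob_space M" and Y: "measurable_field M Y"
    and sq: "\<And>t. integrable M (\<lambda>w. (Y t w)\<^sup>2)" "\<And>t. (\<integral>w. (Y t w)\<^sup>2 \<partial>M) \<le> B"
    and \<phi>: "integrable lborel \<phi>"
  shows "0 \<le> (LINT p|(lborel \<Otimes>\<^sub>M lborel). \<phi> (fst p) * \<phi> (snd p) * (\<integral>w. Y (fst p) w * Y (snd p) w \<partial>M))"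
proof -
  interpret prob_space M by fact
  interpret P: pair_sigma_finite "lborel \<Otimes>\<^sub>M lborel :: ('a \<times> 'a) measure" M
    by (simp add: pair_sigma_finite.intro lborel_prod lborel.sigma_finite_measure_axioms sigma_finite_measure_axioms)
  have [measurable]: "\<phi> \<in> borel_measurable borel" using \<phi> by auto
  have Ym[measurable]: "(\<lambda>p. Y (fst p) (snd p)) \<in> borel_measurable (borel \<Otimes>\<^sub>M M)"
    using Y unfolding measurable_field_def by (simp add: case_prod_beta')
  have [measurable]: "Y t \<in> borel_measurable M" for t by (rule measurable_field_at[OF Y])
  have "(\<lambda>x. (fst (fst x), snd x)) \<in> (lborel \<Otimes>\<^sub>M lborel) \<Otimes>\<^sub>M M \<rightarrow>\<^sub>M borel \<Otimes>\<^sub>M M"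
    by (intro measurable_Pair) (simp_all flip: measurable_lborel2)
  from measurable_compose[OF this Ym]
  have Y1: "(\<lambda>x. Y (fst (fst x)) (snd x)) \<in> borel_measurable ((lborel \<Otimes>\<^sub>M lborel) \<Otimes>\<^sub>M M)"
    by simp
  have "(\<lambda>x. (snd (fst x), snd x)) \<in> (lborel \<Otimes>\<^sub>M lborel) \<Otimes>\<^sub>M M \<rightarrow>\<^sub>M borel \<Otimes>\<^sub>M M"
    by (intro measurable_Pair) (simp_all flip: measurable_lborel2)
  from measurable_compose[OF this Ym]
  have Y2: "(\<lambda>x. Y (snd (fst x)) (snd x)) \<in> borel_measurable ((lborel \<Otimes>\<^sub>M lborel) \<Otimes>\<^sub>M M)"
    by simp
  define F where "F p w = \<phi> (fst p) * \<phi> (snd p) * (Y (fst p) w * Y (snd p) w)" for p w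
  have Fm: "(\<lambda>x. F (fst x) (snd x)) \<in> borel_measurable ((lborel \<Otimes>\<^sub>M lborel) \<Otimes>\<^sub>M M)"
    unfolding F_def using Y1 Y2 by measurable
  have int1: "integrable M (F p)" for p
    unfolding F_def by (intro integrable_mult_right integrable_times_of_squares sq) auto
  have "integrable (lborel \<Otimes>\<^sub>M lborel) (\<lambda>p. \<integral>w. norm (F p w) \<partial>M)"
  proof (rule Bochner_Integration.integrable_bound)
    show "integrable (lborel \<Otimes>\<^sub>M lborel) (\<lambda>p. B * (\<phi> (fst p) * \<phi> (snd p)))"
      using integrable_tensor[OF \<phi>] by (intro integrable_mult_right) (simp add: case_prod_beta')
    show "(\<lambda>p. \<integral>w. norm (F p w) \<partial>M) \<in> borel_measurable (lborel \<Otimes>\<^sub>M lborel)"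
      using Fm by (intro borel_measurable_lebesgue_integral) (simp add: case_prod_beta')
    have "norm (\<integral>w. norm (F p w) \<partial>M) \<le> norm (B * (\<phi> (fst p) * \<phi> (snd p)))" for p
    proof -
      have "(\<integral>w. \<bar>Y (fst p) w * Y (snd p) w\<bar> \<partial>M) \<le> B"
        using integrable_times_of_squares(2)[of "Y (fst p)" M "Y (snd p)"] sq(1) sq(2)[of "fst p"] sq(2)[of "snd p"]
        by simp
      moreover have "(\<integral>w. norm (F p w) \<partial>M) = \<bar>\<phi> (fst p) * \<phi> (snd p)\<bar> * (\<integral>w. \<bar>Y (fst p) w * Y (snd p) w\<bar> \<partial>M)"
        unfolding F_def by (simp add: abs_mult flip: mult.assoc) (simp add: mult.assoc)
      moreover have "\<bar>\<phi> (fst p) * \<phi> (snd p)\<bar> * e \<le> norm (B * (\<phi> (fst p) * \<phi> (snd p)))" if "e \<le> B" for e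
        using mult_left_mono[of e "\<bar>B\<bar>" "\<bar>\<phi> (fst p) * \<phi> (snd p)\<bar>"] that by (simp add: abs_mult mult_ac)
      ultimately show ?thesis by simp
    qed
    then show "AE p in lborel \<Otimes>\<^sub>M lborel. norm (\<integral>w. norm (F p w) \<partial>M) \<le> norm (B * (\<phi> (fst p) * \<phi> (snd p)))"
      by simp
  qed
  then have FI: "integrable ((lborel \<Otimes>\<^sub>M lborel) \<Otimes>\<^sub>M M) (\<lambda>x. F (fst x) (snd x))"
    using Fm by (intro P.Fubini_integrable) (auto intro: int1)
  have AE: "AE w in M. integrable (lborel \<Otimes>\<^sub>M lborel) (\<lambda>p. F p w)"
    using P.AE_integrable_snd[of F] FI by (simp add: case_prod_beta')
  have "AE w in M. 0 \<le> (LINT p|(lborel \<Otimes>\<^sub>M lborel). F p w)"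
    using AE
  proof eventually_elim
    case (elim w)
    have "(LINT p|(lborel \<Otimes>\<^sub>M lborel). F p w) = (LINT s|lborel. LINT t|lborel. F (s, t) w)"
      using lborel_pair.integral_fst'[OF elim] by simp
    also have "\<dots> = (LINT s|lborel. (\<phi> s * Y s w) * (LINT t|lborel. \<phi> t * Y t w))"
    proof (rule Bochner_Integration.integral_cong[OF refl])
      fix s
      have "(LINT t|lborel. F (s, t) w) = (LINT t|lborel. (\<phi> s * Y s w) * (\<phi> t * Y t w))"
        unfolding F_def by (simp add: mult_ac)
      then show "(LINT t|lborel. F (s, t) w) = (\<phi> s * Y s w) * (LINT t|lborel. \<phi> t * Y t w)"
        by simp
    qed
    also have "\<dots> = (LINT t|lborel. \<phi> t * Y t w)\<^sup>2"
      by (simp add: power2_eq_square)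
    finally show ?case by simp
  qed
  then have "0 \<le> (\<integral>w. (LINT p|(lborel \<Otimes>\<^sub>M lborel). F p w) \<partial>M)"
    by (rule integral_nonneg_AE)
  also have "\<dots> = (LINT p|(lborel \<Otimes>\<^sub>M lborel). (\<integral>w. F p w \<partial>M))"
    using P.Fubini_integral[of F] FI by (simp add: case_prod_beta')
  also have "\<dots> = (LINT p|(lborel \<Otimes>\<^sub>M lborel). \<phi> (fst p) * \<phi> (snd p) * (\<integral>w. Y (fst p) w * Y (snd p) w \<partial>M))"
    unfolding F_def by simp
  finally show ?thesis .
qed

section \<open>Positive definite kernels and translated boxes\<close>

lemma lborel_integral_reflect:
  fixes s :: "'a::euclidean_space" and f :: "'a \<Rightarrow> real"
  assumes [measurable]: "f \<in> borel_measurable borel"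
  shows "(LINT t|lborel. f (s - t)) = (LINT t|lborel. f t)"
proof -
  have "lborel = density (distr lborel borel (\<lambda>t::'a. s + (-1) *\<^sub>R t)) (\<lambda>_. ennreal \<bar>-1\<bar> ^ DIM('a))"
    using lborel_affine[of "-1" s] by simp
  also have "\<dots> = distr lborel borel (\<lambda>t::'a. s - t)"
    by (simp add: density_1)
  finally have "distr lborel borel (\<lambda>t::'a. s - t) = lborel" ..
  then have "(LINT t|lborel. f t) = (LINT t|distr lborel borel (\<lambda>t::'a. s - t). f t)"
    by simp
  also have "\<dots> = (LINT t|lborel. f (s - t))"
    by (subst integral_distr) auto
  finally show ?thesis by simp
qed

lemma lborel_integral_shift:
  fixes s :: "'a::euclidean_space" and f :: "'a \<Rightarrow> real"
  assumes [measurable]: "f \<in> borel_measurable borel"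
  shows "(LINT t|lborel. f (s + t)) = (LINT t|lborel. f t)"
proof -
  have "(LINT t|lborel. f t) = (LINT t|distr lborel borel ((+) s). f t)"
    by (simp add: lborel_distr_plus)
  also have "\<dots> = (LINT t|lborel. f (s + t))"
    by (subst integral_distr) auto
  finally show ?thesis by simp
qed

lemma integrable_indicator_mult_bounded:
  fixes C :: "'a \<Rightarrow> real"
  assumes "A \<in> sets M" "emeasure M A < \<infinity>" and [measurable]: "C \<in> borel_measurable M"
    and "\<And>t. \<bar>C t\<bar> \<le> 1"
  shows "integrable M (\<lambda>t. indicator A t * C t)"
proof (rule integrableI_bounded_set[where A=A and B=1])
  show "(\<lambda>t. indicator A t * C t) \<in> borel_measurable M" using assms(1) by measurable
  show "AE x in M. x \<in> A \<longrightarrow> norm (indicator A x * C x) \<le> 1"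
    using assms(4) by (auto simp: indicator_def)
qed (use assms in auto)

text \<open>Test positive definiteness with the difference of the indicators of \<open>P\<close> and of
  \<open>Q' = Q - a\<close>. The two diagonal terms average \<open>C\<close> over \<open>P - P\<close> and \<open>Q - Q\<close>, which lie in
  \<open>E\<close>; the mixed term with \<open>s \<in> P\<close>, \<open>t \<in> Q'\<close> sees all of \<open>a + D\<close> for each \<open>s\<close>, because
  \<open>s - D \<subseteq> Q\<close>. The other mixed term is simply discarded, as \<open>C \<ge> 0\<close>. Taking \<open>Q\<close> larger
  than \<open>P\<close> avoids computing the convolution of two indicators.\<close>

lemma posdef_translate_le:
  fixes C :: "'a::euclidean_space \<Rightarrow> real"
  assumes [measurable]: "C \<in> borel_measurable borel"
    and C0: "\<And>t. 0 \<le> C t" and C1: "\<And>t. C t \<le> 1" and pd: "kernel_posdef C"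
    and meas[measurable]: "P \<in> sets borel" "Q \<in> sets borel" "E \<in> sets borel"
    and fin: "emeasure lborel P < \<infinity>" "emeasure lborel Q < \<infinity>" "emeasure lborel E < \<infinity>"
    and D: "\<And>s u. s \<in> P \<Longrightarrow> u \<in> D \<Longrightarrow> s - u \<in> Q"
    and EP: "\<And>s t. s \<in> P \<Longrightarrow> t \<in> P \<Longrightarrow> s - t \<in> E"
    and EQ: "\<And>s t. s \<in> Q \<Longrightarrow> t \<in> Q \<Longrightarrow> s - t \<in> E"
  shows "measure lborel P * (LINT u|lborel. indicator D u * C (a + u))
       \<le> (measure lborel P + measure lborel Q) * (LINT u|lborel. indicator E u * C u)"
proof -
  define Q' where "Q' = (\<lambda>t. a + t) -` Q"
  have Q'[measurable]: "Q' \<in> sets borel"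
    unfolding Q'_def using measurable_sets_borel[of "\<lambda>t. a + t" borel Q] by simp
  have emQ': "emeasure lborel Q' = emeasure lborel Q"
  proof -
    have "emeasure (distr lborel borel ((+) a)) Q = emeasure lborel Q'"
      unfolding Q'_def by (subst emeasure_distr) (auto simp: vimage_def)
    then show ?thesis by (simp add: lborel_distr_plus)
  qed
  have mQ': "measure lborel Q' = measure lborel Q"
    using emQ' by (simp add: measure_def)
  define G where "G A B p = (indicator A (fst p) * indicator B (snd p) * C (fst p - snd p) :: real)"
    for A B and p :: "'a \<times> 'a"
  define I where "I A B = (LINT p|(lborel \<Otimes>\<^sub>M lborel). G A B p)" for A B
  have intG: "integrable (lborel \<Otimes>\<^sub>M lborel) (G A B)"
    if [measurable]: "A \<in> sets borel" "B \<in> sets borel"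
      and "emeasure lborel A < \<infinity>" "emeasure lborel B < \<infinity>" for A B
  proof -
    have "integrable (lborel \<Otimes>\<^sub>M lborel) (\<lambda>p. indicator (A \<times> B) p * C (fst p - snd p))"
      using that C0 C1
      by (intro integrable_indicator_mult_bounded)
         (auto simp: lborel.emeasure_pair_measure_Times ennreal_mult_less_top)
    then show ?thesis
      unfolding G_def by (simp add: indicator_times mult.assoc)
  qed
  have iter: "I A B = (LINT s|lborel. indicator A s * (LINT t|lborel. indicator B t * C (s - t)))"
    if "A \<in> sets borel" "B \<in> sets borel"
      and "emeasure lborel A < \<infinity>" "emeasure lborel B < \<infinity>" for A B
    unfolding I_def lborel_pair.integral_fst'[OF intG[OF that], symmetric]
    by (simp add: G_def mult.assoc)
  have inner: "(LINT t|lborel. indicator B t * C (s - t)) = (LINT t|lborel. indicator B (s - t) * C t)"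
    if [measurable]: "B \<in> sets borel" for B s
    using lborel_integral_reflect[of "\<lambda>t. indicator B (s - t) * C t" s] by simp
  have intE: "integrable lborel (\<lambda>t. indicator E t * C t)"
    using fin C0 C1 by (intro integrable_indicator_mult_bounded) auto
  have diag: "I A A \<le> measure lborel A * (LINT u|lborel. indicator E u * C u)"
    if A[measurable]: "A \<in> sets borel" and finA: "emeasure lborel A < \<infinity>"
      and sub: "\<And>s t. s \<in> A \<Longrightarrow> t \<in> A \<Longrightarrow> s - t \<in> E" for A
  proof -
    have "I A A \<le> (LINT s|lborel. indicator A s * (LINT u|lborel. indicator E u * C u))"
      unfolding iter[OF A A finA finA]
    proof (rule integral_mono)
      show "integrable lborel (\<lambda>s. indicator A s * (LINT t|lborel. indicator A t * C (s - t)))"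
        using lborel_pair.integrable_fst'[OF intG[OF A A finA finA]] by (simp add: G_def mult.assoc)
      show "integrable lborel (\<lambda>s. indicator A s * (LINT u|lborel. indicator E u * C u))"
        using A finA by (intro integrable_mult_left integrable_real_indicator) auto
      fix s
      show "indicator A s * (LINT t|lborel. indicator A t * C (s - t))
          \<le> indicator A s * (LINT u|lborel. indicator E u * C u)"
      proof (cases "s \<in> A")
        case True
        have "indicator A (s - t) * C t \<le> indicator E t * C t" for t
          using sub[OF True, of "s - t"] C0[of t] by (auto simp: indicator_def)
        then have "(LINT t|lborel. indicator A (s - t) * C t) \<le> (LINT u|lborel. indicator E u * C u)"
          using C0 intE by (intro integral_mono') auto
        then show ?thesis using inner[OF A] by (simp add: True)
      qed simp
    qed
    also have "\<dots> = measure lborel A * (LINT u|lborel. indicator E u * C u)"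
      by simp
    finally show ?thesis .
  qed
  have Q'E: "s - t \<in> E" if "s \<in> Q'" "t \<in> Q'" for s t
    using EQ[of "a + s" "a + t"] that by (simp add: Q'_def)
  have lower: "measure lborel P * (LINT u|lborel. indicator D u * C (a + u)) \<le> I P Q'"
  proof -
    have finQ': "emeasure lborel Q' < \<infinity>" using fin emQ' by simp
    have "(LINT s|lborel. indicator P s * (LINT u|lborel. indicator D u * C (a + u))) \<le> I P Q'"
      unfolding iter[OF meas(1) Q' fin(1) finQ']
    proof (rule integral_mono)
      show "integrable lborel (\<lambda>s. indicator P s * (LINT t|lborel. indicator Q' t * C (s - t)))"
        using lborel_pair.integrable_fst'[OF intG[OF meas(1) Q' fin(1) finQ']]
        by (simp add: G_def mult.assoc)
      show "integrable lborel (\<lambda>s. indicator P s * (LINT u|lborel. indicator D u * C (a + u)))"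
        using fin by (intro integrable_mult_left integrable_real_indicator) auto
      fix s
      show "indicator P s * (LINT u|lborel. indicator D u * C (a + u))
          \<le> indicator P s * (LINT t|lborel. indicator Q' t * C (s - t))"
      proof (cases "s \<in> P")
        case True
        have "(LINT t|lborel. indicator Q' t * C (s - t)) = (LINT t|lborel. indicator Q' (s - t) * C t)"
          by (rule inner) simp
        also have "\<dots> = (LINT u|lborel. indicator Q' (s - (a + u)) * C (a + u))"
          using lborel_integral_shift[of "\<lambda>t. indicator Q' (s - t) * C t" a] by simp
        also have "\<dots> = (LINT u|lborel. indicator Q (s - u) * C (a + u))"
          by (simp add: Q'_def indicator_def algebra_simps)
        finally have eq: "(LINT t|lborel. indicator Q' t * C (s - t))
          = (LINT u|lborel. indicator Q (s - u) * C (a + u))" .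
        have "emeasure lborel ((\<lambda>u. s - u) -` Q) < \<infinity>"
        proof -
          have "(\<lambda>u. s - u) -` Q = (\<lambda>q. s + (-1) *\<^sub>R q) ` Q"
            by (auto simp: image_iff intro!: bexI[of _ "s - _"])
          then have "emeasure lebesgue ((\<lambda>u. s - u) -` Q) = emeasure lebesgue Q"
            using emeasure_lebesgue_affine[of "-1" s Q] by simp
          moreover have "(\<lambda>u. s - u) -` Q \<in> sets borel"
            using measurable_sets_borel[of "\<lambda>u. s - u" borel Q] by simp
          ultimately show ?thesis using fin(2) by simp
        qed
        then have "integrable lborel (\<lambda>u. indicator ((\<lambda>u. s - u) -` Q) u * C (a + u))"
          using C0 C1 measurable_sets_borel[of "\<lambda>u. s - u" borel Q]
          by (intro integrable_indicator_mult_bounded) auto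
        moreover have "indicator D u * C (a + u) \<le> indicator ((\<lambda>u. s - u) -` Q) u * C (a + u)" for u
          using D[OF True] C0[of "a + u"] by (auto simp: indicator_def)
        ultimately have "(LINT u|lborel. indicator D u * C (a + u))
          \<le> (LINT u|lborel. indicator ((\<lambda>u. s - u) -` Q) u * C (a + u))"
          using C0 by (intro integral_mono') auto
        then show ?thesis using True eq by (simp add: indicator_def)
      qed simp
    qed
    then show ?thesis by simp
  qed
  have finQ': "emeasure lborel Q' < \<infinity>" using fin emQ' by simp
  note intGs = intG[OF meas(1) meas(1) fin(1) fin(1)] intG[OF meas(1) Q' fin(1) finQ']
    intG[OF Q' meas(1) finQ' fin(1)] intG[OF Q' Q' finQ' finQ']
  have "integrable lborel (\<lambda>s. indicator P s - indicator Q' s :: real)"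
    using fin finQ' by (intro Bochner_Integration.integrable_diff integrable_real_indicator) auto
  then have "0 \<le> (LINT p|(lborel \<Otimes>\<^sub>M lborel). (indicator P (fst p) - indicator Q' (fst p))
      * (indicator P (snd p) - indicator Q' (snd p)) * C (fst p - snd p))"
    using pd unfolding kernel_posdef_def by blast
  also have "\<dots> = (LINT p|(lborel \<Otimes>\<^sub>M lborel). (G P P p - G P Q' p) - (G Q' P p - G Q' Q' p))"
    by (simp add: G_def algebra_simps)
  also have "\<dots> = (I P P - I P Q') - (I Q' P - I Q' Q')"
    unfolding I_def using intGs by simp
  finally have "I P Q' + I Q' P \<le> I P P + I Q' Q'" by simp
  moreover have "0 \<le> I Q' P"
    unfolding I_def by (intro integral_nonneg_AE) (use C0 in \<open>auto simp: G_def\<close>)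
  ultimately show ?thesis
    using lower diag[OF meas(1) fin(1) EP] diag[OF Q' finQ' Q'E]
    by (simp add: mQ' algebra_simps)
qed

definition centred_box :: "('d::finite \<Rightarrow> real) \<Rightarrow> (real ^ 'd) set" where
  "centred_box v = {t. \<forall>i. \<bar>t $ i\<bar> \<le> v i}"

lemma centred_box_cbox: "centred_box v = cbox (- (\<chi> i. v i)) (\<chi> i. v i)"
  by (auto simp: centred_box_def mem_box_cart abs_le_iff minus_le_iff)

lemma centred_box_measurable [measurable]: "centred_box v \<in> sets borel"
  by (simp add: centred_box_cbox)

lemma emeasure_centred_box_finite: "emeasure lborel (centred_box v) < top"
  using emeasure_lborel_cbox_finite by (simp add: centred_box_cbox)

lemma measure_centred_box:
  fixes v :: "'d::finite \<Rightarrow> real"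
  assumes "\<And>i. 0 \<le> v i"
  shows "measure lborel (centred_box v) = (\<Prod>i\<in>UNIV. 2 * v i)"
proof -
  have "cbox (- (\<chi> i. v i)) (\<chi> i. v i) \<noteq> {}"
    using assms by (auto simp: interval_ne_empty_cart)
  from content_cbox_cart[OF this] show ?thesis
    by (simp add: centred_box_cbox)
qed

text \<open>The box \<open>v\<close> serves as both \<open>P\<close> and \<open>D\<close> in \<open>posdef_translate_le\<close>, and the box \<open>2 v\<close> as \<open>Q\<close>:
  differences of points of the box \<open>v\<close> lie in the box \<open>2 v\<close>, and differences of points of the
  latter in the box \<open>4 v\<close>. The constant is one plus the volume ratio of the two boxes.\<close>

lemma posdef_translated_box_le:
  fixes C :: "real ^ 'd \<Rightarrow> real"
  assumes "C \<in> borel_measurable borel" "\<And>t. 0 \<le> C t" "\<And>t. C t \<le> 1" "kernel_posdef C"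
    and v: "\<And>i. 0 < v i"
  shows "(LINT u|lborel. indicator (centred_box v) u * C (a + u))
    \<le> (1 + 2 ^ CARD('d)) * (LINT u|lborel. indicator (centred_box (\<lambda>i. 4 * v i)) u * C u)"
proof -
  let ?P = "centred_box v" and ?Q = "centred_box (\<lambda>i. 2 * v i)"
  have E: "s - t \<in> centred_box (\<lambda>i. 4 * v i)" if "s \<in> ?Q" "t \<in> ?Q" for s t
    unfolding centred_box_def
  proof safe
    fix i
    have "\<bar>s $ i\<bar> \<le> 2 * v i" "\<bar>t $ i\<bar> \<le> 2 * v i" using that by (auto simp: centred_box_def)
    then show "\<bar>(s - t) $ i\<bar> \<le> 4 * v i" by simp
  qed
  have sub: "?P \<subseteq> ?Q"
    unfolding centred_box_def using v by (auto intro: order_trans simp: less_imp_le)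
  have PQ: "s - t \<in> ?Q" if "s \<in> ?P" "t \<in> ?P" for s t
    unfolding centred_box_def
  proof safe
    fix i
    have "\<bar>s $ i\<bar> \<le> v i" "\<bar>t $ i\<bar> \<le> v i" using that by (auto simp: centred_box_def)
    then show "\<bar>(s - t) $ i\<bar> \<le> 2 * v i" by simp
  qed
  have le: "measure lborel ?P * (LINT u|lborel. indicator ?P u * C (a + u))
      \<le> (measure lborel ?P + measure lborel ?Q)
        * (LINT u|lborel. indicator (centred_box (\<lambda>i. 4 * v i)) u * C u)"
    by (rule posdef_translate_le) (use assms E PQ sub in \<open>auto simp: emeasure_centred_box_finite subset_eq\<close>)
  have Q: "measure lborel ?Q = 2 ^ CARD('d) * measure lborel ?P"
  proof -
    have "0 \<le> v i" "0 \<le> 2 * v i" for i using v[of i] by auto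
    then show ?thesis by (simp only: measure_centred_box prod.distrib prod_constant)
  qed
  have "0 < measure lborel ?P"
    using v by (simp add: measure_centred_box less_imp_le prod_pos)
  then show ?thesis
  proof (rule mult_le_cancel_left_pos[THEN iffD1])
    show "measure lborel ?P * (LINT u|lborel. indicator ?P u * C (a + u))
      \<le> measure lborel ?P
        * ((1 + 2 ^ CARD('d)) * (LINT u|lborel. indicator (centred_box (\<lambda>i. 4 * v i)) u * C u))"
      using le unfolding Q by (simp only: distrib_right distrib_left mult_1_left mult.assoc mult.left_commute)
  qed
qed

text \<open>One finite set \<open>S\<close>, obtained from total boundedness of the unit box, works for all boxes at
  once after scaling the coordinates. This uniformity in \<open>r\<close> is essential when the side lengths
  grow at different rates.\<close>

lemma centred_box_cover:
  assumes "0 < \<rho>"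
  obtains S :: "(real ^ 'd) set" where "finite S"
    "\<And>r t. (\<And>i. 0 < r i) \<Longrightarrow> t \<in> centred_box r
      \<Longrightarrow> \<exists>a\<in>S. t - (\<chi> i. r i * a $ i) \<in> centred_box (\<lambda>i. \<rho> * r i)"
proof -
  have "compact (centred_box (\<lambda>_. 1) :: (real ^ 'd) set)"
    by (simp add: centred_box_cbox)
  then obtain S :: "(real ^ 'd) set" where S: "finite S" "centred_box (\<lambda>_. 1) \<subseteq> (\<Union>a\<in>S. ball a \<rho>)"
    using assms unfolding compact_eq_totally_bounded by blast
  show ?thesis
  proof (rule that[OF S(1)])
    fix r :: "'d \<Rightarrow> real" and t :: "real ^ 'd"
    assume r: "\<And>i. 0 < r i" and t: "t \<in> centred_box r"
    have "(\<chi> i. t $ i / r i) \<in> centred_box (\<lambda>_. 1)"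
      using t r by (simp add: centred_box_def abs_divide less_imp_le)
    then obtain a where a: "a \<in> S" "dist a (\<chi> i. t $ i / r i) < \<rho>"
      using S(2) by auto
    have "\<bar>(t - (\<chi> i. r i * a $ i)) $ i\<bar> \<le> \<rho> * r i" for i
    proof -
      have "\<bar>a $ i - t $ i / r i\<bar> < \<rho>"
        using component_le_norm_cart[of "a - (\<chi> i. t $ i / r i)" i] a(2) by (simp add: dist_norm)
      then have "r i * \<bar>a $ i - t $ i / r i\<bar> \<le> r i * \<rho>" using r[of i] by simp
      moreover have "r i * \<bar>a $ i - t $ i / r i\<bar> = \<bar>t $ i - r i * a $ i\<bar>"
      proof -
        have "r i * \<bar>a $ i - t $ i / r i\<bar> = \<bar>r i * (a $ i - t $ i / r i)\<bar>"
          using r[of i] by (simp add: abs_mult)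
        also have "r i * (a $ i - t $ i / r i) = r i * a $ i - t $ i"
          using r[of i] by (simp add: right_diff_distrib)
        finally show ?thesis by (simp add: abs_minus_commute)
      qed
      ultimately show ?thesis by (simp add: mult.commute)
    qed
    then show "\<exists>a\<in>S. t - (\<chi> i. r i * a $ i) \<in> centred_box (\<lambda>i. \<rho> * r i)"
      using a(1) unfolding centred_box_def by blast
  qed
qed

text \<open>Cover the box \<open>r\<close> by translates of the box \<open>\<eta> r / 4\<close>; each of them carries at most a constant
  times the mass of the centred box \<open>\<eta> r\<close>.\<close>

lemma posdef_box_shrink:
  fixes C :: "real ^ 'd \<Rightarrow> real"
  assumes C[measurable]: "C \<in> borel_measurable borel" and C0: "\<And>t. 0 \<le> C t" and C1: "\<And>t. C t \<le> 1"
    and pd: "kernel_posdef C" and \<eta>: "0 < \<eta>"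
  obtains K where "0 < K" "\<And>r. (\<And>i. 0 < r i) \<Longrightarrow>
    (LINT t|lborel. indicator (centred_box r) t * C t)
      \<le> K * (LINT t|lborel. indicator (centred_box (\<lambda>i. \<eta> * r i)) t * C t)"
proof -
  obtain S :: "(real ^ 'd) set" where S: "finite S"
    "\<And>r t. (\<And>i. 0 < r i) \<Longrightarrow> t \<in> centred_box r
      \<Longrightarrow> \<exists>a\<in>S. t - (\<chi> i. r i * a $ i) \<in> centred_box (\<lambda>i. \<eta> / 4 * r i)"
    using centred_box_cover[of "\<eta> / 4"] \<eta> by auto
  \<comment> \<open>The summand 1 only keeps \<open>K\<close> positive, should \<open>S\<close> be empty.\<close>
  define K where "K = 1 + real (card S) * (1 + 2 ^ CARD('d))"
  show ?thesis
  proof (rule that[of K])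
    show "0 < K" unfolding K_def by (simp add: add_pos_nonneg)
    fix r :: "'d \<Rightarrow> real" assume r: "\<And>i. 0 < r i"
    let ?J = "LINT t|lborel. indicator (centred_box (\<lambda>i. \<eta> * r i)) t * C t"
    let ?B = "centred_box (\<lambda>i. \<eta> / 4 * r i)"
    define sh where "sh a = (\<chi> i. r i * a $ i)" for a :: "real ^ 'd"
    have J0: "0 \<le> ?J" using C0 by (intro integral_nonneg_AE) auto
    have int: "integrable lborel (\<lambda>t. indicator ?B (t - sh a) * C t)" for a
    proof -
      have "integrable lborel (\<lambda>t. indicator ?B t * C (sh a + t))"
        using C0 C1 by (intro integrable_indicator_mult_bounded) (auto simp: emeasure_centred_box_finite)
      then have "integrable (distr lborel borel ((+) (sh a))) (\<lambda>t. indicator ?B (t - sh a) * C t)"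
        by (subst integrable_distr_eq) auto
      then show ?thesis by (simp add: lborel_distr_plus)
    qed
    have "(LINT t|lborel. indicator (centred_box r) t * C t)
        \<le> (LINT t|lborel. (\<Sum>a\<in>S. indicator ?B (t - sh a) * C t))"
    proof (rule integral_mono')
      show "integrable lborel (\<lambda>t. \<Sum>a\<in>S. indicator ?B (t - sh a) * C t)"
        using int by simp
      fix t
      show nn: "0 \<le> (\<Sum>a\<in>S. indicator ?B (t - sh a) * C t)"
        using C0 by (intro sum_nonneg) auto
      show "indicator (centred_box r) t * C t \<le> (\<Sum>a\<in>S. indicator ?B (t - sh a) * C t)"
      proof (cases "t \<in> centred_box r")
        case True
        then obtain a where a: "a \<in> S" "t - sh a \<in> ?B"
          using S(2)[of r t] r unfolding sh_def by blast
        have "C t = indicator ?B (t - sh a) * C t" using a by simp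
        also have "\<dots> \<le> (\<Sum>a\<in>S. indicator ?B (t - sh a) * C t)"
          using a S(1) C0 by (intro member_le_sum) auto
        finally show ?thesis using True by simp
      qed (use nn in simp)
    qed
    also have "\<dots> = (\<Sum>a\<in>S. LINT t|lborel. indicator ?B (t - sh a) * C t)"
      by (rule Bochner_Integration.integral_sum) (use int in simp)
    also have "\<dots> \<le> (\<Sum>a\<in>S. (1 + 2 ^ CARD('d)) * ?J)"
    proof (rule sum_mono)
      fix a
      have "(LINT t|lborel. indicator ?B (t - sh a) * C t) = (LINT u|lborel. indicator ?B u * C (sh a + u))"
        using lborel_integral_shift[of "\<lambda>t. indicator ?B (t - sh a) * C t" "sh a"] by simp
      also have "\<dots> \<le> (1 + 2 ^ CARD('d)) * ?J"
        using posdef_translated_box_le[OF C C0 C1 pd, of "\<lambda>i. \<eta> / 4 * r i" "sh a"] r \<eta> by simp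
      finally show "(LINT t|lborel. indicator ?B (t - sh a) * C t) \<le> (1 + 2 ^ CARD('d)) * ?J" .
    qed
    also have "\<dots> \<le> K * ?J"
      using J0 unfolding K_def by (simp add: algebra_simps)
    finally show "(LINT t|lborel. indicator (centred_box r) t * C t) \<le> K * ?J" .
  qed
qed

section \<open>Overlaps of a set with its translates\<close>

lemma mem_translate_iff:
  fixes A :: "'a::ab_group_add set"
  shows "y \<in> (\<lambda>x. x - s) ` A \<longleftrightarrow> y + s \<in> A"
proof
  show "y + s \<in> A \<Longrightarrow> y \<in> (\<lambda>x. x - s) ` A"
    by (rule image_eqI[of _ _ "y + s"]) auto
qed auto

lemma lborel_translate:
  fixes A :: "'a::euclidean_space set"
  assumes A: "A \<in> sets borel"
  shows sets_translate: "(\<lambda>x. x - s) ` A \<in> sets borel"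
    and emeasure_lborel_translate: "emeasure lborel ((\<lambda>x. x - s) ` A) = emeasure lborel A"
proof -
  have eq: "(\<lambda>x. x - s) ` A = (+) s -` A"
    by (auto simp: mem_translate_iff add.commute simp del: image_iff)
  show "(\<lambda>x. x - s) ` A \<in> sets borel"
    unfolding eq using measurable_sets_borel[of "(+) s" borel A] A by simp
  have "emeasure (distr lborel borel ((+) s)) A = emeasure lborel ((+) s -` A)"
    using A by (subst emeasure_distr) auto
  then show "emeasure lborel ((\<lambda>x. x - s) ` A) = emeasure lborel A"
    by (simp add: lborel_distr_plus eq)
qed

lemma fmeasurable_translate:
  fixes A :: "'a::euclidean_space set"
  assumes "A \<in> fmeasurable lborel"
  shows "(\<lambda>x. x - s) ` A \<in> fmeasurable lborel"
    and "measure lborel ((\<lambda>x. x - s) ` A) = measure lborel A"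
  using assms lborel_translate[of A s] by (auto simp: fmeasurable_def measure_def)

lemma overlap_le:
  fixes A :: "'a::euclidean_space set"
  assumes "A \<in> fmeasurable lborel"
  shows "overlap A t \<le> measure lborel A"
  unfolding overlap_def using assms fmeasurable_translate(1)[OF assms, of t]
  by (intro measure_mono_fmeasurable) (auto simp: fmeasurable_def)

lemma overlap_mono:
  fixes A :: "'a::euclidean_space set"
  assumes "A \<subseteq> B" "A \<in> fmeasurable lborel" "B \<in> fmeasurable lborel"
  shows "overlap A t \<le> overlap B t"
  unfolding overlap_def using assms fmeasurable_translate(1)[of _ t]
  by (intro measure_mono_fmeasurable fmeasurable_Int_fmeasurable) (auto simp: fmeasurable_def)

lemma compact_fmeasurable_lborel:
  fixes K :: "'a::euclidean_space set"
  shows "compact K \<Longrightarrow> K \<in> fmeasurable lborel"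
  using emeasure_compact_finite[of K] by (auto simp: fmeasurable_def less_top borel_compact)

text \<open>Closed sets approximate from inside up to a set of small measure; cutting with large balls
  makes them compact.\<close>

lemma inner_compact_lborel:
  fixes V :: "'a::euclidean_space set"
  assumes V: "V \<in> fmeasurable lborel" and e: "0 < e"
  obtains K where "compact K" "K \<subseteq> V" "measure lborel V - e < measure lborel K"
proof -
  have Vb: "V \<in> sets borel" using fmeasurableD[OF V] by simp
  then have Vl: "V \<in> sets lebesgue" by simp
  obtain T where T: "closed T" "T \<subseteq> V" "V - T \<in> lmeasurable"
      "emeasure lebesgue (V - T) < ennreal (e / 2)"
    using sets_lebesgue_inner_closed[OF Vl, of "e / 2"] e by auto
  have Tb: "T \<in> sets borel" using T by simp
  have Tf: "T \<in> fmeasurable lborel"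
    by (rule fmeasurableI2[OF V T(2)]) (simp add: Tb)
  have "measure lborel V - measure lborel T = measure lborel (V - T)"
    using measurable_measure_Diff[OF V _ T(2)] Tb by simp
  moreover have "measure lborel (V - T) < e / 2"
  proof -
    have "V - T \<in> sets borel" using Vb Tb by simp
    then have "emeasure lborel (V - T) < ennreal (e / 2)" using T(4) by simp
    then show ?thesis
      unfolding measure_def using e by (cases "emeasure lborel (V - T)") (auto simp: ennreal_less_iff)
  qed
  ultimately have 1: "measure lborel V - e / 2 < measure lborel T" by simp
  have "(\<lambda>n. measure lborel (T \<inter> cball 0 (real n))) \<longlonglongrightarrow> measure lborel (\<Union>n. T \<inter> cball 0 (real n))"
  proof (rule Lim_measure_incseq)
    show "incseq (\<lambda>n. T \<inter> cball 0 (real n))" by (auto simp: incseq_def)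
    show "emeasure lborel (\<Union>n. T \<inter> cball 0 (real n)) \<noteq> \<infinity>"
    proof -
      have "emeasure lborel (\<Union>n. T \<inter> cball 0 (real n)) \<le> emeasure lborel T"
        using Tb by (intro emeasure_mono) auto
      then show ?thesis using Tf unfolding fmeasurable_def by (auto simp: top_unique)
    qed
  qed (use Tb in auto)
  moreover have "(\<Union>n. T \<inter> cball 0 (real n)) = T"
  proof (intro equalityI subsetI)
    fix x assume "x \<in> T"
    moreover obtain n where "norm x \<le> real n" using real_arch_simple by blast
    ultimately show "x \<in> (\<Union>n. T \<inter> cball 0 (real n))" by auto
  qed auto
  ultimately have "(\<lambda>n. measure lborel (T \<inter> cball 0 (real n))) \<longlonglongrightarrow> measure lborel T" by simp
  from order_tendstoD(1)[OF this, of "measure lborel T - e / 2"] e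
  obtain n where "measure lborel T - e / 2 < measure lborel (T \<inter> cball 0 (real n))"
    by (auto simp: eventually_sequentially)
  with 1 T show ?thesis
    by (intro that[of "T \<inter> cball 0 (real n)"]) auto
qed

text \<open>This is continuity of \<open>overlap V\<close> at the origin. Approximate \<open>V\<close> from inside by a compact \<open>K\<close>,
  and \<open>K\<close> from outside by an open \<open>U\<close>. For small \<open>s\<close> both \<open>K\<close> and \<open>K - s\<close> lie in \<open>U\<close>, whose
  measure barely exceeds that of \<open>K\<close>, so they have to overlap almost completely.\<close>

lemma overlap_near_zero:
  fixes V :: "'a::euclidean_space set"
  assumes V: "V \<in> fmeasurable lborel" and e: "0 < e"
  obtains \<eta> where "0 < \<eta>" "\<And>s. norm s < \<eta> \<Longrightarrow> measure lborel V - e < overlap V s"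
proof -
  obtain K where K: "compact K" "K \<subseteq> V" "measure lborel V - e / 2 < measure lborel K"
    using inner_compact_lborel[OF V, of "e / 2"] e by auto
  have Kf: "K \<in> fmeasurable lborel" by (rule compact_fmeasurable_lborel) fact
  then have Kb: "K \<in> sets borel" by (simp add: fmeasurable_def)
  obtain U where U: "open U" "K \<subseteq> U" "emeasure lborel (U - K) < ennreal (e / 2)"
    using outer_regular_lborel[OF Kb, of "e / 2"] e by auto
  have UKf: "U - K \<in> fmeasurable lborel"
    using U Kb by (auto simp: fmeasurable_def intro: less_trans)
  have UK: "measure lborel (U - K) < e / 2"
    unfolding measure_def using e U(3) by (cases "emeasure lborel (U - K)") (auto simp: ennreal_less_iff)
  have Ueq: "K \<union> U = U" using U by auto
  have Uf: "U \<in> fmeasurable lborel" using fmeasurable.Un[OF Kf UKf] Ueq by simp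
  have mU: "measure lborel U \<le> measure lborel K + measure lborel (U - K)"
    using measure_Un_le[OF fmeasurableD[OF Kf] fmeasurableD[OF UKf]] Ueq by simp
  obtain \<eta> where \<eta>: "0 < \<eta>" "(\<Union>x\<in>K. ball x \<eta>) \<subseteq> U"
    using compact_subset_open_imp_ball_epsilon_subset[OF K(1) U(1,2)] by auto
  show ?thesis
  proof (rule that[OF \<eta>(1)])
    fix s :: 'a assume s: "norm s < \<eta>"
    let ?K = "(\<lambda>x. x - s) ` K"
    have sub: "K \<union> ?K \<subseteq> U"
    proof -
      have "x - s \<in> ball x \<eta>" for x using s by (simp add: dist_norm)
      then show ?thesis using \<eta>(2) U(2) by blast
    qed
    note K' = fmeasurable_translate[OF Kf, of s]
    have "measure lborel (K \<union> ?K) = measure lborel K + measure lborel ?K - measure lborel (K \<inter> ?K)"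
      using measure_Un3[OF Kf K'(1)] .
    moreover have "measure lborel (K \<union> ?K) \<le> measure lborel U"
      using sub Kf K'(1) Uf by (intro measure_mono_fmeasurable) (auto simp: fmeasurable_def)
    moreover have "overlap K s \<le> overlap V s" using K(2) Kf V by (rule overlap_mono)
    ultimately show "measure lborel V - e < overlap V s"
      using K'(2) mU UK K(3) unfolding overlap_def by linarith
  qed
qed

text \<open>A point of \<open>V \<inter> (V - s)\<close> outside \<open>A \<inter> (A - s)\<close> lies in \<open>V - A\<close> or in a translate of it.\<close>

lemma overlap_perturb:
  fixes V A :: "'a::euclidean_space set"
  assumes V: "V \<in> fmeasurable lborel" and A: "A \<in> fmeasurable lborel"
  shows "overlap V s - 2 * measure lborel (V - A) \<le> overlap A s"
proof -
  let ?t = "\<lambda>S. (\<lambda>x. x - s) ` S"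
  have D: "V - A \<in> fmeasurable lborel" using V A by (intro fmeasurable.Diff)
  note D' = fmeasurable_translate[OF D, of s] and A' = fmeasurable_translate(1)[OF A, of s]
  have A2: "A \<inter> ?t A \<in> fmeasurable lborel" using A A' by (intro fmeasurable.Int)
  have "overlap V s \<le> measure lborel ((A \<inter> ?t A) \<union> ((V - A) \<union> ?t (V - A)))"
    unfolding overlap_def using A2 D D' V fmeasurable_translate(1)[OF V, of s]
    by (intro measure_mono_fmeasurable fmeasurable.Un) (auto simp: fmeasurable_def)
  also have "\<dots> \<le> overlap A s + measure lborel ((V - A) \<union> ?t (V - A))"
    unfolding overlap_def using A2 D D' by (intro measure_Un_le) (auto simp: fmeasurable_def)
  also have "measure lborel ((V - A) \<union> ?t (V - A)) \<le> measure lborel (V - A) + measure lborel (?t (V - A))"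
    using D D' by (intro measure_Un_le) (auto simp: fmeasurable_def)
  finally show ?thesis using D'(2) by simp
qed

lemma rescale_measure:
  fixes S :: "(real ^ 'd) set"
  assumes S: "S \<in> fmeasurable lborel" "rescale r S \<in> sets borel" and r: "\<And>l. 0 < r l"
  shows "measure lborel S = (\<Prod>l\<in>UNIV. r l) * measure lborel (rescale r S)"
proof -
  have "S \<in> lmeasurable" using S(1) by (auto simp: fmeasurable_def)
  then have "measure lebesgue ((\<lambda>x. \<chi> k. inverse (r k) * x $ k) ` S)
      = \<bar>\<Prod>k\<in>UNIV. inverse (r k)\<bar> * measure lebesgue S"
    by (rule measure_stretch)
  moreover have "(\<lambda>x. \<chi> k. inverse (r k) * x $ k) ` S = rescale r S"
    unfolding rescale_def by (simp add: field_simps)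
  moreover have "S \<in> sets lborel" using S by (auto simp: fmeasurable_def)
  moreover have R: "0 < (\<Prod>l\<in>UNIV. r l)" by (intro prod_pos) (use r in auto)
  moreover have "\<bar>\<Prod>k\<in>UNIV. inverse (r k)\<bar> = inverse (\<Prod>l\<in>UNIV. r l)"
    using R prod_inversef[of r UNIV] by (simp add: comp_def)
  ultimately have "measure lborel (rescale r S) = inverse (\<Prod>l\<in>UNIV. r l) * measure lborel S"
    using S(2) by simp
  moreover have "b = c * a" if "0 < c" "a = inverse c * b" for a b c :: real
    using that by simp
  ultimately show ?thesis using R by blast
qed

lemma compact_rescale: "compact A \<Longrightarrow> compact (rescale r A)"
  unfolding rescale_def divide_inverse
  by (intro compact_continuous_image continuous_intros)

lemma overlap_rescale:
  fixes W :: "(real ^ 'd) set"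
  assumes W: "compact W" and r: "\<And>l. 0 < r l"
  shows "overlap W t = (\<Prod>l\<in>UNIV. r l) * overlap (rescale r W) (\<chi> l. t $ l / r l)"
proof -
  have inj: "inj (\<lambda>x::real ^ 'd. \<chi> l. x $ l / r l)"
    by (rule injI) (use r in \<open>auto simp: vec_eq_iff less_le\<close>)
  have c: "compact (W \<inter> (\<lambda>x. x - t) ` W)"
    using W by (intro compact_Int compact_continuous_image continuous_intros)
  have "rescale r (W \<inter> (\<lambda>x. x - t) ` W)
      = rescale r W \<inter> (\<lambda>x. x - (\<chi> l. t $ l / r l)) ` rescale r W"
    unfolding rescale_def image_Int[OF inj] image_image
    by (simp add: vec_eq_iff diff_divide_distrib vector_minus_component[abs_def] minus_vec_def)
  then show ?thesis
    unfolding overlap_def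
    using rescale_measure[of "W \<inter> (\<lambda>x. x - t) ` W" r] c r compact_rescale[OF c, of r]
    by (simp add: compact_fmeasurable_lborel borel_compact)
qed

text \<open>The overlap of a compact set is bounded and has bounded support; it is Borel, being the
  integral over \<open>x\<close> of a function that is jointly Borel in \<open>x\<close> and \<open>t\<close>.\<close>

lemma integrable_mult_overlap:
  fixes f :: "'a::euclidean_space \<Rightarrow> real"
  assumes W: "compact W" and f[measurable]: "f \<in> borel_measurable borel" and f1: "\<And>t. \<bar>f t\<bar> \<le> 1"
  shows "integrable lborel (\<lambda>t. f t * overlap W t)"
proof -
  have Wf: "W \<in> fmeasurable lborel" using W by (rule compact_fmeasurable_lborel)
  then have Wb[measurable]: "W \<in> sets borel" by (auto simp: fmeasurable_def)
  have eq: "overlap W = (\<lambda>t. LINT x|lborel. indicator W x * indicator W (x + t))"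
  proof
    fix t
    have "(LINT x|lborel. indicator W x * indicator W (x + t) :: real)
        = (LINT x|lborel. indicator (W \<inter> (\<lambda>x. x - t) ` W) x)"
      by (intro Bochner_Integration.integral_cong refl)
         (simp add: indicator_def mem_translate_iff)
    then show "overlap W t = (LINT x|lborel. indicator W x * indicator W (x + t))"
      by (simp add: overlap_def)
  qed
  have m: "overlap W \<in> borel_measurable borel"
    unfolding eq by (rule lborel.borel_measurable_lebesgue_integral) simp
  obtain B where B: "\<And>x. x \<in> W \<Longrightarrow> norm x \<le> B"
    using compact_imp_bounded[OF W] by (auto simp: bounded_iff)
  show ?thesis
  proof (rule integrableI_bounded_set[where A="cball 0 (B + B)" and B="measure lborel W"])
    show "(\<lambda>t. f t * overlap W t) \<in> borel_measurable lborel" using m f by simp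
    have "norm (f t * overlap W t) \<le> measure lborel W" for t
      using mult_mono[OF f1[of t] overlap_le[OF Wf, of t]] by (simp add: abs_mult overlap_def)
    then show "AE t in lborel. t \<in> cball 0 (B + B) \<longrightarrow> norm (f t * overlap W t) \<le> measure lborel W"
      by simp
    have "f t * overlap W t = 0" if "t \<notin> cball 0 (B + B)" for t
    proof -
      have "W \<inter> (\<lambda>x. x - t) ` W = {}"
      proof (rule ccontr)
        assume "W \<inter> (\<lambda>x. x - t) ` W \<noteq> {}"
        then obtain x y where "x \<in> W" "y \<in> W" "x = y - t" by auto
        then have "norm t \<le> B + B" using norm_triangle_ineq4[of y x] B[of x] B[of y] by simp
        with that show False by simp
      qed
      then show ?thesis by (simp add: overlap_def)
    qed
    then show "AE t in lborel. t \<notin> cball 0 (B + B) \<longrightarrow> f t * overlap W t = 0" by simp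
    show "emeasure lborel (cball 0 (B + B) :: 'a set) < \<infinity>"
      using emeasure_compact_finite[of "cball 0 (B + B)"] by (simp add: less_top)
  qed simp
qed

section \<open>The ratio of overlap integrals\<close>

lemma norm_less_of_centred_box:
  fixes s :: "real ^ 'd"
  assumes "0 < \<epsilon>" "s \<in> centred_box (\<lambda>_. \<epsilon> / (2 * CARD('d)))"
  shows "norm s < \<epsilon>"
proof -
  have "norm s \<le> (\<Sum>i\<in>UNIV. \<bar>s $ i\<bar>)" by (rule norm_le_l1_cart)
  also have "\<dots> \<le> (\<Sum>i\<in>(UNIV :: 'd set). \<epsilon> / (2 * CARD('d)))"
    using assms(2) by (intro sum_mono) (simp add: centred_box_def)
  also have "\<dots> = \<epsilon> / 2" by simp
  finally show ?thesis using assms(1) by simp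
qed

text \<open>The analytic core, in which the random field appears only through its covariance. The
  denominator dominates \<open>R\<^sub>n J\<^sub>n\<close>, where \<open>J\<^sub>n\<close> is the integral of \<open>C\<close> over the shrunken box and tends
  to infinity, while the numerator exceeds a small multiple of the denominator by at most a
  constant times \<open>R\<^sub>n\<close>.\<close>

proposition posdef_overlap_ratio:
  fixes C :: "real ^ 'd \<Rightarrow> real" and r :: "nat \<Rightarrow> 'd \<Rightarrow> real"
  assumes C[measurable]: "C \<in> borel_measurable borel" and C0: "\<And>t. 0 \<le> C t" and C1: "\<And>t. C t \<le> 1"
    and pd: "kernel_posdef C" and lim: "(C \<longlongrightarrow> 0) at_infinity"
    and W: "\<And>n. compact (W n)" and r: "\<And>n l. 0 < r n l"
    and V: "V \<in> fmeasurable lborel" "0 < measure lborel V"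
    and ratio: "\<forall>\<^sub>F n in sequentially. measure lborel (W n) \<le> 2 * (measure lborel V * (\<Prod>l\<in>UNIV. r n l))"
    and conv: "(\<lambda>n. measure lborel (V - rescale (r n) (W n))) \<longlonglongrightarrow> 0"
    and box: "filterlim (\<lambda>n. LINT t|lborel. indicator (centred_box (r n)) t * C t) at_top sequentially"
  shows "\<forall>\<^sub>F n in sequentially. 0 < (LINT t|lborel. C t * overlap (W n) t)"
    and "(\<lambda>n. (LINT t|lborel. (C t)\<^sup>2 * overlap (W n) t)
               / (LINT t|lborel. C t * overlap (W n) t)) \<longlonglongrightarrow> 0"
proof -
  define m where "m = measure lborel V"
  define R where "R n = (\<Prod>l\<in>UNIV. r n l)" for n
  define Den where "Den n = (LINT t|lborel. C t * overlap (W n) t)" for n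
  define Num where "Num n = (LINT t|lborel. (C t)\<^sup>2 * overlap (W n) t)" for n
  have m: "0 < m" using V by (simp add: m_def)
  have R: "0 < R n" for n unfolding R_def by (intro prod_pos) (use r in auto)
  have Wf: "W n \<in> fmeasurable lborel" for n using W by (rule compact_fmeasurable_lborel)
  have ov0: "0 \<le> overlap (W n) t" for n t by (simp add: overlap_def)
  have Csq: "(C t)\<^sup>2 \<le> 1" for t using C0[of t] C1[of t] by (simp add: power_le_one)
  have intD: "integrable lborel (\<lambda>t. C t * overlap (W n) t)" for n
    by (rule integrable_mult_overlap) (use W C0 C1 in auto)
  have intN: "integrable lborel (\<lambda>t. (C t)\<^sup>2 * overlap (W n) t)" for n
    by (rule integrable_mult_overlap) (use W Csq in auto)
  \<comment> \<open>The overlap of \<open>V\<close> keeps \<open>3 m / 4\<close> near the origin, and at most \<open>m / 4\<close> is lost in passing to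
    the rescaled windows, which leaves \<open>m / 2\<close>.\<close>
  obtain \<epsilon> where \<epsilon>: "0 < \<epsilon>" "\<And>s. norm s < \<epsilon> \<Longrightarrow> m - m / 4 < overlap V s"
    using overlap_near_zero[OF V(1), of "m / 4"] m unfolding m_def by auto
  define \<eta> where "\<eta> = \<epsilon> / (2 * CARD('d))"
  have \<eta>: "0 < \<eta>" using \<epsilon> by (simp add: \<eta>_def)
  define J where "J n = (LINT t|lborel. indicator (centred_box (\<lambda>i. \<eta> * r n i)) t * C t)" for n
  obtain K where K: "0 < K" "\<And>n. (LINT t|lborel. indicator (centred_box (r n)) t * C t) \<le> K * J n"
    using posdef_box_shrink[OF C C0 C1 pd \<eta>] r unfolding J_def by metis
  have "filterlim (\<lambda>n. K * J n) at_top sequentially"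
    by (rule filterlim_at_top_mono[OF box]) (use K in simp)
  then have J: "filterlim J at_top sequentially"
    using K(1) by (simp add: filterlim_tendsto_pos_mult_at_top_iff[OF tendsto_const])
  have lower: "\<forall>\<^sub>F n in sequentially. m / 2 * R n * J n \<le> Den n"
  proof -
    have "\<forall>\<^sub>F n in sequentially. measure lborel (V - rescale (r n) (W n)) < m / 8"
      using order_tendstoD(2)[OF conv, of "m / 8"] m by simp
    then show ?thesis
    proof eventually_elim
      case (elim n)
      let ?A = "rescale (r n) (W n)"
      have A: "?A \<in> fmeasurable lborel"
        by (intro compact_fmeasurable_lborel compact_rescale W)
      have "m / 2 * R n * J n = (LINT t|lborel. m / 2 * R n * (indicator (centred_box (\<lambda>i. \<eta> * r n i)) t * C t))"
        by (simp add: J_def)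
      also have "\<dots> \<le> Den n"
        unfolding Den_def
      proof (rule integral_mono'[OF intD])
        fix t
        show "0 \<le> C t * overlap (W n) t" using C0 ov0 by simp
        show "m / 2 * R n * (indicator (centred_box (\<lambda>i. \<eta> * r n i)) t * C t) \<le> C t * overlap (W n) t"
        proof (cases "t \<in> centred_box (\<lambda>i. \<eta> * r n i)")
          case True
          let ?s = "\<chi> l. t $ l / r n l"
          have "?s \<in> centred_box (\<lambda>_. \<eta>)"
            using True r by (auto simp: centred_box_def abs_divide divide_le_eq abs_of_pos)
          then have "norm ?s < \<epsilon>"
            using norm_less_of_centred_box[OF \<epsilon>(1), of ?s] by (simp add: \<eta>_def)
          then have half: "m / 2 \<le> overlap ?A ?s"
            using \<epsilon>(2)[of ?s] overlap_perturb[OF V(1) A, of ?s] elim by linarith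
          have eq: "overlap (W n) t = R n * overlap ?A ?s"
            unfolding R_def by (rule overlap_rescale[OF W r])
          have "m / 2 * R n \<le> overlap (W n) t"
            using mult_left_mono[OF half, of "R n"] R[of n]
            by (simp add: eq mult.commute[of _ "R n"])
          from mult_right_mono[OF this C0[of t]] show ?thesis using True by (simp add: mult_ac)
        qed (use C0 ov0 in simp)
      qed
      finally show ?case .
    qed
  qed
  have pos: "\<forall>\<^sub>F n in sequentially. 0 < Den n"
    using lower filterlim_at_top_dense[THEN iffD1, OF J, rule_format, of 0]
  proof eventually_elim
    case (elim n)
    have "0 < m / 2 * R n * J n" using m R[of n] elim by simp
    then show ?case using elim by simp
  qed
  then show "\<forall>\<^sub>F n in sequentially. 0 < (LINT t|lborel. C t * overlap (W n) t)"
    unfolding Den_def .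
  have "(\<lambda>n. Num n / Den n) \<longlonglongrightarrow> 0"
  proof (rule tendstoI)
    fix e :: real assume e: "0 < e"
    have "\<forall>\<^sub>F t in at_infinity. C t < e / 2"
      using order_tendstoD(2)[OF lim, of "e / 2"] e by simp
    then obtain B where B: "\<And>t. B \<le> norm t \<Longrightarrow> C t < e / 2"
      by (auto simp: eventually_at_infinity)
    \<comment> \<open>Outside the ball the factor \<open>C\<close> is small; inside it the integrand is at most the measure of the
      window.\<close>
    define c where "c = measure lborel (cball (0 :: real ^ 'd) B)"
    have c0: "0 \<le> c" by (simp add: c_def)
    have split: "Num n \<le> e / 2 * Den n + measure lborel (W n) * c" for n
    proof -
      have intB: "integrable lborel (\<lambda>t. measure lborel (W n) * indicator (cball (0 :: real ^ 'd) B) t)"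
        using compact_fmeasurable_lborel[of "cball (0 :: real ^ 'd) B"]
        by (intro integrable_mult_right integrable_real_indicator) (auto simp: fmeasurable_def)
      have "Num n \<le> (LINT t|lborel. e / 2 * (C t * overlap (W n) t)
          + measure lborel (W n) * indicator (cball (0 :: real ^ 'd) B) t)"
        unfolding Num_def
      proof (rule integral_mono[OF intN])
        show "integrable lborel (\<lambda>t. e / 2 * (C t * overlap (W n) t)
          + measure lborel (W n) * indicator (cball (0 :: real ^ 'd) B) t)"
          using intD intB by simp
        fix t
        show "(C t)\<^sup>2 * overlap (W n) t \<le> e / 2 * (C t * overlap (W n) t)
          + measure lborel (W n) * indicator (cball (0 :: real ^ 'd) B) t"
        proof (cases "t \<in> cball (0 :: real ^ 'd) B")
          case True
          have "(C t)\<^sup>2 * overlap (W n) t \<le> 1 * measure lborel (W n)"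
            using Csq overlap_le[OF Wf] ov0 by (intro mult_mono) auto
          moreover have "0 \<le> e / 2 * (C t * overlap (W n) t)" using e C0 ov0 by simp
          ultimately show ?thesis using True by simp
        next
          case False
          then have "C t * (C t * overlap (W n) t) \<le> e / 2 * (C t * overlap (W n) t)"
            using B[of t] C0 ov0 by (intro mult_right_mono) auto
          then show ?thesis using False by (simp add: power2_eq_square mult.assoc)
        qed
      qed
      also have "\<dots> = e / 2 * Den n + measure lborel (W n) * c"
        using intD intB by (simp add: Den_def c_def)
      finally show ?thesis .
    qed
    show "\<forall>\<^sub>F n in sequentially. dist (Num n / Den n) 0 < e"
      using lower pos ratio filterlim_at_top_dense[THEN iffD1, OF J, rule_format, of "8 * c / e"]
      \<comment> \<open>At \<open>J\<^sub>n = 8 c / e\<close> the two bounds \<open>2 m R\<^sub>n c\<close> and \<open>(e / 2) (m / 2) R\<^sub>n J\<^sub>n\<close> coincide.\<close>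
    proof eventually_elim
      case (elim n)
      have "measure lborel (W n) * c \<le> 2 * (m * R n) * c"
        using elim(3) c0 unfolding m_def R_def by (rule mult_right_mono)
      also have "\<dots> = m * R n * (2 * c)" by simp
      also have "\<dots> < m * R n * (e / 4 * J n)"
        using elim(4) e m R[of n] by (intro mult_strict_left_mono) (auto simp: field_simps)
      also have "\<dots> = e / 2 * (m / 2 * R n * J n)" by simp
      also have "\<dots> \<le> e / 2 * Den n" using elim(1) e by (intro mult_left_mono) auto
      finally have "Num n < e * Den n" using split[of n] by simp
      moreover have "0 \<le> Num n"
        unfolding Num_def using ov0 by (intro integral_nonneg_AE) auto
      ultimately show ?case using elim(2) by (simp add: divide_less_eq abs_of_nonneg)
    qed
  qed
  then show "(\<lambda>n. (LINT t|lborel. (C t)\<^sup>2 * overlap (W n) t)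
               / (LINT t|lborel. C t * overlap (W n) t)) \<longlonglongrightarrow> 0"
    unfolding Num_def Den_def .
qed

theorem corollary2p6:
  fixes M :: "'w measure"
    and Y :: "real ^ 'd \<Rightarrow> 'w \<Rightarrow> real"
    and C :: "real ^ 'd \<Rightarrow> real"
    and W :: "nat \<Rightarrow> (real ^ 'd) set"
    and r :: "nat \<Rightarrow> 'd \<Rightarrow> real"
    and V :: "(real ^ 'd) set"
    and \<delta> :: real
  assumes "prob_space M"
    and "measurable_field M Y"
    and "gaussian_field M Y"
    and "centered_field M Y"
    and "stationary_field M Y"
    and "\<And>t. C t = (\<integral>w. Y t w * Y 0 w \<partial>M)"
    and "(\<integral>w. (Y 0 w)\<^sup>2 \<partial>M) = 1"
    and "gaussian_PA M Y \<or> gaussian_NA M Y"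
    and "(C \<longlongrightarrow> 0) at_infinity"
    and "van_Hove W"
    and "\<And>n l. 0 < r n l"
    and "(SUP n. emeasure lborel (rescale (r n) (W n))) < \<infinity>"
    and "V \<in> sets borel"
    and "(\<lambda>n. measure lborel (W n) / (measure lborel V * (\<Prod>l\<in>UNIV. r n l))) \<longlonglongrightarrow> 1"
    and "(\<lambda>n. emeasure lborel (sym_diff V (rescale (r n) (W n)))) \<longlonglongrightarrow> 0"
    and "0 < \<delta>" and "\<delta> < 1"
    and "filterlim
           (\<lambda>n. (\<Prod>i\<in>UNIV. r n i powr (-1 + \<delta>)) *
                (LINT t:{t. \<forall>i. \<bar>t $ i\<bar> \<le> r n i}|lborel. C t))
           at_top sequentially"
  shows "(\<forall>\<^sub>F n in sequentially. (LINT t|lborel. C t * overlap (W n) t) \<noteq> 0) \<and>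
         (\<lambda>n. (LINT t|lborel. (C t)\<^sup>2 * overlap (W n) t)
               / (LINT t|lborel. C t * overlap (W n) t)) \<longlonglongrightarrow> 0"
proof -
  interpret prob_space M by fact
  note meas = measurable_field_at[OF assms(2)]
  have mom: "(\<integral>w. Y s w * Y t w \<partial>M) = C (s - t)" for s t
    using stationary_second_moment(1)[OF assms(5) meas, of "s - t" t 0] assms(6)[of "s - t"] by simp
  \<comment> \<open>The integral of a non-integrable function is zero, so the variance being 1 entails square
    integrability.\<close>
  have "integrable M (\<lambda>w. Y 0 w * Y 0 w)"
    using assms(7) not_integrable_integral_eq[of M "\<lambda>w. (Y 0 w)\<^sup>2"]
    by (fastforce simp: power2_eq_square)
  then have sq: "integrable M (\<lambda>w. (Y t w)\<^sup>2)" for t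
    using stationary_second_moment(2)[OF assms(5) meas, of 0 t 0] by (simp add: power2_eq_square)
  have sq1: "(\<integral>w. (Y t w)\<^sup>2 \<partial>M) = 1" for t
    using mom[of t t] mom[of 0 0] assms(7) by (simp add: power2_eq_square)
  have cov: "field_cov M Y s t = C (s - t)" for s t
    using assms(4) mom unfolding field_cov_def centered_field_def by simp
  have C_le: "C t \<le> 1" for t
  proof -
    have "C t \<le> (\<integral>w. \<bar>Y t w * Y 0 w\<bar> \<partial>M)"
      unfolding assms(6) by (rule order_trans[OF abs_ge_self integral_abs_bound])
    also have "\<dots> \<le> 1"
      using integrable_times_of_squares(2)[OF meas meas sq sq, of t 0] by (simp add: sq1)
    finally show ?thesis .
  qed
  have C_meas: "C \<in> borel_measurable borel"
  proof -
    have "(\<lambda>x. Y (fst x) (snd x)) \<in> borel_measurable (borel \<Otimes>\<^sub>M M)"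
      using assms(2) unfolding measurable_field_def by (simp add: case_prod_beta')
    from borel_measurable_times[OF this measurable_compose[OF measurable_snd meas[of 0]]]
    have "(\<lambda>(t, w). Y t w * Y 0 w) \<in> borel_measurable (borel \<Otimes>\<^sub>M M)"
      by (simp add: case_prod_beta')
    then have "(\<lambda>t. \<integral>w. Y t w * Y 0 w \<partial>M) \<in> borel_measurable borel"
      by (rule borel_measurable_lebesgue_integral)
    then show ?thesis using assms(6) by (simp add: fun_eq_iff[symmetric] cong: measurable_cong)
  qed
  have C_pd: "kernel_posdef C"
    unfolding kernel_posdef_def
    using second_moment_posdef[OF assms(1,2) sq, of 1] by (simp add: sq1 mom)
  define I where "I n = (LINT t|lborel. indicator (centred_box (r n)) t * C t)" for n
  define R where "R n = (\<Prod>l\<in>UNIV. r n l)" for n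
  define m where "m = measure lborel V"
  have R: "0 < R n" for n unfolding R_def by (intro prod_pos) (use assms(11) in auto)
  have powR: "(\<Prod>i\<in>UNIV. r n i powr (-1 + \<delta>)) = R n powr (-1 + \<delta>)" for n
    unfolding R_def by (rule prod_powr_distrib[symmetric])
  have hyp: "filterlim (\<lambda>n. R n powr (-1 + \<delta>) * I n) at_top sequentially"
    using assms(18) unfolding powR
    by (simp add: I_def set_lebesgue_integral_def centred_box_def)
  have PA: "gaussian_PA M Y"
  proof (rule ccontr)
    assume "\<not> gaussian_PA M Y"
    then have nonpos: "C t \<le> 0" if "t \<noteq> 0" for t
      using assms(8) that cov[of t 0] unfolding gaussian_NA_def by (metis diff_zero)
    have "AE t in lborel. 0 \<le> - (indicator (centred_box (r n)) t * C t)" for n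
      by (rule AE_mp[OF AE_lborel_singleton[of 0]]) (auto intro!: AE_I2 simp: indicator_def nonpos)
    then have "0 \<le> (LINT t|lborel. - (indicator (centred_box (r n)) t * C t))" for n
      by (rule integral_nonneg_AE)
    then have "I n \<le> 0" for n by (simp add: I_def)
    then have "R n powr (-1 + \<delta>) * I n \<le> 0" for n by (simp add: mult_nonneg_nonpos)
    moreover have "\<forall>\<^sub>F n in sequentially. 0 < R n powr (-1 + \<delta>) * I n"
      using hyp unfolding filterlim_at_top_dense by blast
    ultimately show False
      by (auto simp: eventually_sequentially not_less[symmetric])
  qed
  then have C0: "0 \<le> C t" for t
    using cov[of t 0] unfolding gaussian_PA_def by (metis diff_zero)
  have W: "compact (W n)" for n using assms(10) by (simp add: van_Hove_def)
  have W_top: "filterlim (\<lambda>n. measure lborel (W n)) at_top sequentially"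
    using assms(10) by (simp add: van_Hove_def)
  have ratio_lim: "(\<lambda>n. measure lborel (W n) / (m * R n)) \<longlonglongrightarrow> 1"
    using assms(14) by (simp add: m_def R_def)
  \<comment> \<open>Division by zero yields zero, so a limit set with \<open>m = 0\<close> would make all the ratios vanish. This
    also excludes a set of infinite volume, for which \<open>measure\<close> returns zero.\<close>
  have m: "0 < m"
  proof (rule ccontr)
    assume "\<not> 0 < m"
    then have "m = 0" unfolding m_def using measure_nonneg[of lborel V] by linarith
    then show False using ratio_lim LIMSEQ_const_iff[of "0 :: real" 1] by simp
  qed
  have V: "V \<in> fmeasurable lborel"
    using m assms(13) unfolding m_def fmeasurable_def measure_def
    by (cases "emeasure lborel V") auto
  have ratio: "\<forall>\<^sub>F n in sequentially. measure lborel (W n) \<le> 2 * (m * R n)"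
  proof -
    have "\<forall>\<^sub>F n in sequentially. measure lborel (W n) / (m * R n) < 2"
      using order_tendstoD(2)[OF ratio_lim, of 2] by simp
    then show ?thesis
      by eventually_elim (use m R in \<open>simp add: divide_less_eq less_imp_le\<close>)
  qed
  have R1: "\<forall>\<^sub>F n in sequentially. 1 \<le> R n"
  proof -
    have "\<forall>\<^sub>F n in sequentially. 2 * m \<le> measure lborel (W n)"
      using W_top unfolding filterlim_at_top by blast
    with ratio show ?thesis
    proof eventually_elim
      case (elim n)
      then have "m * 1 \<le> m * R n" by simp
      then show ?case using m by simp
    qed
  qed
  have I_top: "filterlim I at_top sequentially"
  proof (rule filterlim_at_top_mono[OF hyp])
    have I0: "0 \<le> I n" for n
      unfolding I_def using C0 by (intro integral_nonneg_AE) auto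
    show "\<forall>\<^sub>F n in sequentially. R n powr (-1 + \<delta>) * I n \<le> I n"
      using R1
    proof eventually_elim
      case (elim n)
      have "R n powr (-1 + \<delta>) \<le> R n powr 0"
        using elim assms(17) by (intro powr_mono) auto
      then show ?case
        using mult_right_mono[OF _ I0[of n], of "R n powr (-1 + \<delta>)" 1] elim by simp
    qed
  qed
  have conv: "(\<lambda>n. measure lborel (V - rescale (r n) (W n))) \<longlonglongrightarrow> 0"
  proof -
    have A: "rescale (r n) (W n) \<in> sets borel" for n
      by (intro borel_compact compact_rescale W)
    have "(\<lambda>n. emeasure lborel (V - rescale (r n) (W n))) \<longlonglongrightarrow> 0"
    proof (rule tendsto_sandwich[OF _ _ tendsto_const assms(15)])
      show "\<forall>\<^sub>F n in sequentially. emeasure lborel (V - rescale (r n) (W n))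
          \<le> emeasure lborel (sym_diff V (rescale (r n) (W n)))"
        using assms(13) A by (intro always_eventually allI emeasure_mono) auto
    qed simp
    then show ?thesis
      using tendsto_enn2real[of _ 0] by (simp add: measure_def)
  qed
  note concl = posdef_overlap_ratio[OF C_meas C0 C_le C_pd assms(9) W assms(11) V _ _ conv]
  have main: "\<forall>\<^sub>F n in sequentially. 0 < (LINT t|lborel. C t * overlap (W n) t)"
    "(\<lambda>n. (LINT t|lborel. (C t)\<^sup>2 * overlap (W n) t)
               / (LINT t|lborel. C t * overlap (W n) t)) \<longlonglongrightarrow> 0"
    using concl m ratio I_top unfolding m_def R_def I_def by simp_all
  then show ?thesis
    by (auto elim: eventually_mono)
qed

end
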